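(* Let $(D,\mu,\tilde\alpha,\tilde\beta)$ be a BiHom-associative algebra and $\alpha,\beta:D\to D$ two multiplicative linear maps such that any two of the maps $\tilde\alpha,\tilde\beta,\alpha,\beta$ commute. Let $T:D\otimes D\to D\otimes D$ be a linear map and assume that there exist two linear maps $\tilde T_1,\tilde T_2:D\otimes D\otimes D\to D\otimes D\otimes D$ such that the following relations hold: \begin{gather*} (\alpha\otimes\alpha)\circ T=T\circ(\alpha\otimes\alpha),\qquad (\beta\otimes\beta)\circ T=T\circ(\beta\otimes\beta),\\ (\tilde\alpha\otimes\tilde\alpha)\circ T=T\circ(\tilde\alpha\otimes\tilde\alpha),\qquad (\tilde\beta\otimes\tilde\beta)\circ T=T\circ(\tilde\beta\otimes\tilde\beta),\\ T\circ(\tilde\alpha\otimes\mu)=(\tilde\alpha\otimes\mu)\circ\tilde T_1\circ(T\otimes\mathrm{id}_D),\\ T\circ(\mu\otimes\tilde\beta)=(\mu\otimes\tilde\beta)\circ\tilde T_2\circ(\mathrm{id}_D\otimes T),\\ \tilde T_1\circ(T\otimes\mathrm{id}_D)\circ(\alpha\otimes T)=\tilde T_2\circ(\mathrm{id}_D\otimes T)\circ(T\otimes\beta). \end{gather*} Then $D^T_{\alpha,\beta}:=(D,\mu\circ T,\tilde\alpha\circ\alpha,\tilde\beta\circ\beta)$ is also a BiHom-associative algebra.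
   Context: All vector spaces are over a field $\Bbbk$; algebras are not assumed unital. A BiHom-associative algebra is a 4-tuple $(A,\mu,\alpha,\beta)$ with $A$ a vector space and $\mu:A\otimes A\to A$ (written $\mu(a\otimes a')=aa'$), $\alpha,\beta:A\to A$ linear maps such that $\alpha\circ\beta=\beta\circ\alpha$, $\alpha(aa')=\alpha(a)\alpha(a')$, $\beta(aa')=\beta(a)\beta(a')$ and $\alpha(a)(a'a'')=(aa')\beta(a'')$ for all $a,a',a''\in A$. A linear map $f:D\to D$ is multiplicative if $f(dd')=f(d)f(d')$ for all $d,d'$. *)

theory Defs
  imports "HOL-Algebra.AbelCoset" "Jordan_Normal_Form.Missing_VectorSpace"
begin

section \<open>Tensor products of vector spaces\<close>

text \<open>Vector spaces are modelled by the locale \<^locale>\<open>vectorspace\<close> and linear maps by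
  \<^const>\<open>module_hom\<close>. All maps are only meaningful on carriers. The record fields
  \<open>mult\<close> and \<open>one\<close> of a module are never used; they get dummy values below.\<close>

text \<open>Finitely supported functions on \<open>S\<close>, as a subspace of all functions.\<close>

definition free_module :: "('k, 'r) ring_scheme \<Rightarrow> 's set \<Rightarrow> ('k, 's \<Rightarrow> 'k) module" where
  "free_module K S =
     (ring.func_space K S)\<lparr>carrier := {x \<in> S \<rightarrow>\<^sub>E carrier K. finite {s \<in> S. x s \<noteq> \<zero>\<^bsub>K\<^esub>}}\<rparr>"

definition free_gen :: "('k, 'r) ring_scheme \<Rightarrow> 's set \<Rightarrow> 's \<Rightarrow> 's \<Rightarrow> 'k" where
  "free_gen K S s = (\<lambda>t\<in>S. if t = s then \<one>\<^bsub>K\<^esub> else \<zero>\<^bsub>K\<^esub>)"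

text \<open>\<open>c X\<close> need not be a full coset (e.g. for \<open>c = 0\<close>), hence the summand \<open>N\<close> in \<open>smult\<close>.\<close>

definition quotient_module :: "('k, 'v, 'm) module_scheme \<Rightarrow> 'v set \<Rightarrow> ('k, 'v set) module" where
  "quotient_module M N =
     \<lparr>carrier = a_rcosets\<^bsub>M\<^esub> N, mult = (\<lambda>X Y. N), one = N, zero = N,
      add = (\<lambda>X Y. X <+>\<^bsub>M\<^esub> Y),
      smult = (\<lambda>c X. N <+>\<^bsub>M\<^esub> ((\<lambda>x. c \<odot>\<^bsub>M\<^esub> x) ` X))\<rparr>"

abbreviation tensor_free ::
  "('k, 'r) ring_scheme \<Rightarrow> ('k, 'v, 'm) module_scheme \<Rightarrow> ('k, 'w, 'n) module_scheme
    \<Rightarrow> ('k, 'v \<times> 'w \<Rightarrow> 'k) module" where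
  "tensor_free K V W \<equiv> free_module K (carrier V \<times> carrier W)"

definition tensor_relations ::
  "('k, 'r) ring_scheme \<Rightarrow> ('k, 'v, 'm) module_scheme \<Rightarrow> ('k, 'w, 'n) module_scheme
    \<Rightarrow> ('v \<times> 'w \<Rightarrow> 'k) set" where
  "tensor_relations K V W =
    (let F = tensor_free K V W; e = (\<lambda>v w. free_gen K (carrier V \<times> carrier W) (v, w)) in
      {e (v \<oplus>\<^bsub>V\<^esub> v') w \<ominus>\<^bsub>F\<^esub> (e v w \<oplus>\<^bsub>F\<^esub> e v' w) | v v' w.
         v \<in> carrier V \<and> v' \<in> carrier V \<and> w \<in> carrier W} \<union>
      {e v (w \<oplus>\<^bsub>W\<^esub> w') \<ominus>\<^bsub>F\<^esub> (e v w \<oplus>\<^bsub>F\<^esub> e v w') | v w w'.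
         v \<in> carrier V \<and> w \<in> carrier W \<and> w' \<in> carrier W} \<union>
      {e (c \<odot>\<^bsub>V\<^esub> v) w \<ominus>\<^bsub>F\<^esub> c \<odot>\<^bsub>F\<^esub> e v w | c v w.
         c \<in> carrier K \<and> v \<in> carrier V \<and> w \<in> carrier W} \<union>
      {e v (c \<odot>\<^bsub>W\<^esub> w) \<ominus>\<^bsub>F\<^esub> c \<odot>\<^bsub>F\<^esub> e v w | c v w.
         c \<in> carrier K \<and> v \<in> carrier V \<and> w \<in> carrier W})"

definition tensor_kernel ::
  "('k, 'r) ring_scheme \<Rightarrow> ('k, 'v, 'm) module_scheme \<Rightarrow> ('k, 'w, 'n) module_scheme
    \<Rightarrow> ('v \<times> 'w \<Rightarrow> 'k) set" where
  "tensor_kernel K V W = module.span K (tensor_free K V W) (tensor_relations K V W)"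

definition tensor ::
  "('k, 'r) ring_scheme \<Rightarrow> ('k, 'v, 'm) module_scheme \<Rightarrow> ('k, 'w, 'n) module_scheme
    \<Rightarrow> ('k, ('v \<times> 'w \<Rightarrow> 'k) set) module" where
  "tensor K V W = quotient_module (tensor_free K V W) (tensor_kernel K V W)"

definition pure_tensor ::
  "('k, 'r) ring_scheme \<Rightarrow> ('k, 'v, 'm) module_scheme \<Rightarrow> ('k, 'w, 'n) module_scheme
    \<Rightarrow> 'v \<Rightarrow> 'w \<Rightarrow> ('v \<times> 'w \<Rightarrow> 'k) set" where
  "pure_tensor K V W v w =
     tensor_kernel K V W +>\<^bsub>tensor_free K V W\<^esub> free_gen K (carrier V \<times> carrier W) (v, w)"

definition bilinear_map ::
  "('k, 'r) ring_scheme \<Rightarrow> ('k, 'v, 'm) module_scheme \<Rightarrow> ('k, 'w, 'n) module_scheme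
    \<Rightarrow> ('k, 'u, 'o) module_scheme \<Rightarrow> ('v \<Rightarrow> 'w \<Rightarrow> 'u) \<Rightarrow> bool" where
  "bilinear_map K V W U B \<longleftrightarrow>
     (\<forall>v \<in> carrier V. B v \<in> module_hom K W U) \<and>
     (\<forall>w \<in> carrier W. (\<lambda>v. B v w) \<in> module_hom K V U)"

text \<open>The linear map on the tensor product induced by a bilinear map; that it is well defined
  is the universal property \<open>tensor_universal\<close> proved below.\<close>

definition tensor_lift ::
  "('k, 'r) ring_scheme \<Rightarrow> ('k, 'v, 'm) module_scheme \<Rightarrow> ('k, 'w, 'n) module_scheme
    \<Rightarrow> ('k, 'u, 'o) module_scheme \<Rightarrow> ('v \<Rightarrow> 'w \<Rightarrow> 'u) \<Rightarrow> ('v \<times> 'w \<Rightarrow> 'k) set \<Rightarrow> 'u" where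
  "tensor_lift K V W U B =
     (THE h. h \<in> module_hom K (tensor K V W) U \<inter> extensional (carrier (tensor K V W)) \<and>
        (\<forall>v \<in> carrier V. \<forall>w \<in> carrier W. h (pure_tensor K V W v w) = B v w))"

text \<open>\<open>f \<otimes> g : V \<otimes> W \<rightarrow> V' \<otimes> W'\<close>\<close>

definition tensor_map ::
  "('k, 'r) ring_scheme \<Rightarrow> ('k, 'v, 'm) module_scheme \<Rightarrow> ('k, 'w, 'n) module_scheme
    \<Rightarrow> ('k, 'v2, 'm2) module_scheme \<Rightarrow> ('k, 'w2, 'n2) module_scheme
    \<Rightarrow> ('v \<Rightarrow> 'v2) \<Rightarrow> ('w \<Rightarrow> 'w2) \<Rightarrow> ('v \<times> 'w \<Rightarrow> 'k) set \<Rightarrow> ('v2 \<times> 'w2 \<Rightarrow> 'k) set" where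
  "tensor_map K V W V' W' f g =
     tensor_lift K V W (tensor K V' W') (\<lambda>v w. pure_tensor K V' W' (f v) (g w))"

text \<open>The canonical isomorphism \<open>(U \<otimes> V) \<otimes> W \<rightarrow> U \<otimes> (V \<otimes> W)\<close> and its inverse.\<close>

definition tensor_assoc ::
  "('k, 'r) ring_scheme \<Rightarrow> ('k, 'u, 'l) module_scheme \<Rightarrow> ('k, 'v, 'm) module_scheme
    \<Rightarrow> ('k, 'w, 'n) module_scheme
    \<Rightarrow> (('u \<times> 'v \<Rightarrow> 'k) set \<times> 'w \<Rightarrow> 'k) set \<Rightarrow> ('u \<times> ('v \<times> 'w \<Rightarrow> 'k) set \<Rightarrow> 'k) set" where
  "tensor_assoc K U V W =
     (let Y = tensor K U (tensor K V W) in
       tensor_lift K (tensor K U V) W Y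
         (\<lambda>x w. tensor_lift K U V Y
            (\<lambda>u v. pure_tensor K U (tensor K V W) u (pure_tensor K V W v w)) x))"

definition tensor_assoc_inv ::
  "('k, 'r) ring_scheme \<Rightarrow> ('k, 'u, 'l) module_scheme \<Rightarrow> ('k, 'v, 'm) module_scheme
    \<Rightarrow> ('k, 'w, 'n) module_scheme
    \<Rightarrow> ('u \<times> ('v \<times> 'w \<Rightarrow> 'k) set \<Rightarrow> 'k) set \<Rightarrow> (('u \<times> 'v \<Rightarrow> 'k) set \<times> 'w \<Rightarrow> 'k) set" where
  "tensor_assoc_inv K U V W =
     (let X = tensor K (tensor K U V) W in
       tensor_lift K U (tensor K V W) X
         (\<lambda>u. tensor_lift K V W X
            (\<lambda>v w. pure_tensor K (tensor K U V) W (pure_tensor K U V u v) w)))"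


subsection \<open>The universal property\<close>

lemma free_module_simps:
  assumes "cring K"
  shows "carrier (free_module K S) = {x \<in> S \<rightarrow>\<^sub>E carrier K. finite {s \<in> S. x s \<noteq> \<zero>\<^bsub>K\<^esub>}}"
    and "\<zero>\<^bsub>free_module K S\<^esub> = (\<lambda>s\<in>S. \<zero>\<^bsub>K\<^esub>)"
    and "x \<oplus>\<^bsub>free_module K S\<^esub> y = (\<lambda>s\<in>S. x s \<oplus>\<^bsub>K\<^esub> y s)"
    and "c \<odot>\<^bsub>free_module K S\<^esub> x = (\<lambda>s\<in>S. c \<otimes>\<^bsub>K\<^esub> x s)"
proof -
  interpret cring K by fact
  show "carrier (free_module K S) = {x \<in> S \<rightarrow>\<^sub>E carrier K. finite {s \<in> S. x s \<noteq> \<zero>\<^bsub>K\<^esub>}}"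
    and "\<zero>\<^bsub>free_module K S\<^esub> = (\<lambda>s\<in>S. \<zero>\<^bsub>K\<^esub>)"
    and "x \<oplus>\<^bsub>free_module K S\<^esub> y = (\<lambda>s\<in>S. x s \<oplus>\<^bsub>K\<^esub> y s)"
    and "c \<odot>\<^bsub>free_module K S\<^esub> x = (\<lambda>s\<in>S. c \<otimes>\<^bsub>K\<^esub> x s)"
    by (simp_all add: free_module_def func_space_def)
qed

lemma free_module_module:
  assumes "cring K"
  shows "module K (free_module K S)"
proof -
  interpret cring K by fact
  interpret F: module K "func_space S" by (rule func_space_is_module)
  let ?N = "{x \<in> S \<rightarrow>\<^sub>E carrier K. finite {s \<in> S. x s \<noteq> \<zero>\<^bsub>K\<^esub>}}"
  have "submodule K ?N (func_space S)"
  proof (rule submodule.intro)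
    show "module K (func_space S)" by (rule F.module_axioms)
    show "?N \<subseteq> carrier (func_space S)" by (auto simp: func_space_def)
    show "\<zero>\<^bsub>func_space S\<^esub> \<in> ?N" by (auto simp: func_space_def)
  next
    fix v w assume vw: "v \<in> ?N" "w \<in> ?N"
    have "{s \<in> S. v s \<oplus>\<^bsub>K\<^esub> w s \<noteq> \<zero>\<^bsub>K\<^esub>} \<subseteq> {s \<in> S. v s \<noteq> \<zero>\<^bsub>K\<^esub>} \<union> {s \<in> S. w s \<noteq> \<zero>\<^bsub>K\<^esub>}"
      using vw by (auto simp: PiE_iff)
    then have "finite {s \<in> S. v s \<oplus>\<^bsub>K\<^esub> w s \<noteq> \<zero>\<^bsub>K\<^esub>}"
      using vw by (auto intro: finite_subset)
    then show "v \<oplus>\<^bsub>func_space S\<^esub> w \<in> ?N"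
      using vw by (auto simp: func_space_def PiE_iff cong: conj_cong)
  next
    fix c v assume cv: "c \<in> carrier K" "v \<in> ?N"
    have "{s \<in> S. c \<otimes>\<^bsub>K\<^esub> v s \<noteq> \<zero>\<^bsub>K\<^esub>} \<subseteq> {s \<in> S. v s \<noteq> \<zero>\<^bsub>K\<^esub>}"
      using cv by auto
    then have "finite {s \<in> S. c \<otimes>\<^bsub>K\<^esub> v s \<noteq> \<zero>\<^bsub>K\<^esub>}"
      using cv by (auto intro: finite_subset)
    then show "c \<odot>\<^bsub>func_space S\<^esub> v \<in> ?N"
      using cv by (auto simp: func_space_def PiE_iff cong: conj_cong)
  qed
  from F.submodule_is_module[OF this] show ?thesis
    by (simp add: free_module_def)
qed

lemma free_gen_closed:
  assumes "cring K" "s \<in> S"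
  shows "free_gen K S s \<in> carrier (free_module K S)"
proof -
  interpret cring K by fact
  have "{t \<in> S. free_gen K S s t \<noteq> \<zero>\<^bsub>K\<^esub>} \<subseteq> {s}" by (auto simp: free_gen_def)
  then have "finite {t \<in> S. free_gen K S s t \<noteq> \<zero>\<^bsub>K\<^esub>}" by (rule finite_subset) simp
  then show ?thesis by (auto simp: free_module_simps[OF assms(1)] free_gen_def)
qed

lemma free_module_hom_eq:
  assumes U: "module K U"
    and f: "f \<in> module_hom K (free_module K S) U" and g: "g \<in> module_hom K (free_module K S) U"
    and gen: "\<And>s. s \<in> S \<Longrightarrow> f (free_gen K S s) = g (free_gen K S s)"
    and x: "x \<in> carrier (free_module K S)"
  shows "f x = g x"
proof -
  interpret U: module K U by fact
  have K: "cring K" ..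
  interpret F: module K "free_module K S" by (rule free_module_module[OF K])
  interpret f: mod_hom K "free_module K S" U f by unfold_locales (rule f)
  interpret g: mod_hom K "free_module K S" U g by unfold_locales (rule g)
  note simps = free_module_simps[OF K]
  have "\<forall>x \<in> carrier (free_module K S). {s \<in> S. x s \<noteq> \<zero>\<^bsub>K\<^esub>} \<subseteq> A \<longrightarrow> f x = g x"
    if "finite A" for A
    using that
  proof (induction A)
    case empty
    show ?case
    proof (intro ballI impI)
      fix x assume x: "x \<in> carrier (free_module K S)" "{s \<in> S. x s \<noteq> \<zero>\<^bsub>K\<^esub>} \<subseteq> {}"
      then have "x = \<zero>\<^bsub>free_module K S\<^esub>"
        by (intro extensionalityI[of _ S]) (auto simp: simps PiE_iff)
      then show "f x = g x" by simp
    qed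
  next
    case (insert p A)
    show ?case
    proof (intro ballI impI)
      fix x assume x: "x \<in> carrier (free_module K S)" and sub: "{s \<in> S. x s \<noteq> \<zero>\<^bsub>K\<^esub>} \<subseteq> insert p A"
      show "f x = g x"
      proof (cases "p \<in> S")
        case False
        then show ?thesis using insert.IH x sub by auto
      next
        case True
        define y where "y = (\<lambda>s\<in>S. if s = p then \<zero>\<^bsub>K\<^esub> else x s)"
        have xp: "x p \<in> carrier K" using x True by (auto simp: simps)
        have "{s \<in> S. y s \<noteq> \<zero>\<^bsub>K\<^esub>} \<subseteq> {s \<in> S. x s \<noteq> \<zero>\<^bsub>K\<^esub>}" by (auto simp: y_def)
        then have "finite {s \<in> S. y s \<noteq> \<zero>\<^bsub>K\<^esub>}"
          by (rule finite_subset) (use x in \<open>auto simp: simps\<close>)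
        then have y: "y \<in> carrier (free_module K S)"
          using x by (auto simp: simps y_def PiE_iff)
        have gp: "free_gen K S p \<in> carrier (free_module K S)"
          by (rule free_gen_closed[OF K True])
        have xy: "x = y \<oplus>\<^bsub>free_module K S\<^esub> x p \<odot>\<^bsub>free_module K S\<^esub> free_gen K S p"
        proof (rule extensionalityI[of _ S])
          fix s assume "s \<in> S"
          then have "x s \<in> carrier K" using x by (auto simp: simps)
          then show "x s = (y \<oplus>\<^bsub>free_module K S\<^esub> x p \<odot>\<^bsub>free_module K S\<^esub> free_gen K S p) s"
            using \<open>s \<in> S\<close> xp by (auto simp: simps y_def free_gen_def)
        qed (use x in \<open>auto simp: simps PiE_iff\<close>)
        have "{s \<in> S. y s \<noteq> \<zero>\<^bsub>K\<^esub>} \<subseteq> A" using sub by (auto simp: y_def)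
        then have "f y = g y" using insert.IH y by blast
        then show ?thesis
          by (subst (1 2) xy) (use y gp xp gen[OF True] in simp)
      qed
    qed
  qed
  then show ?thesis using x by (auto simp: simps)
qed

lemma free_module_hom_ex:
  assumes U: "module K U" and b: "b \<in> S \<rightarrow> carrier U"
  shows "\<exists>f \<in> module_hom K (free_module K S) U. \<forall>s \<in> S. f (free_gen K S s) = b s"
proof -
  interpret U: module K U by fact
  have K: "cring K" ..
  interpret F: module K "free_module K S" by (rule free_module_module[OF K])
  note simps = free_module_simps[OF K]
  define L where "L x = (\<Oplus>\<^bsub>U\<^esub>s\<in>{s \<in> S. x s \<noteq> \<zero>\<^bsub>K\<^esub>}. x s \<odot>\<^bsub>U\<^esub> b s)" for x
  have L_eq: "L x = (\<Oplus>\<^bsub>U\<^esub>s\<in>A. x s \<odot>\<^bsub>U\<^esub> b s)"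
    if "x \<in> S \<rightarrow> carrier K" "finite A" "A \<subseteq> S" "{s \<in> S. x s \<noteq> \<zero>\<^bsub>K\<^esub>} \<subseteq> A" for x A
    unfolding L_def
    by (rule U.add.finprod_mono_neutral_cong_left) (use that b in \<open>auto simp: Pi_iff\<close>)
  have L_closed: "L x \<in> carrier U" if "x \<in> carrier (free_module K S)" for x
    unfolding L_def using that b by (auto intro!: U.M.finsum_closed simp: simps)
  have "L \<in> module_hom K (free_module K S) U"
    unfolding module_hom_def
  proof (intro CollectI conjI allI impI funcsetI)
    show "L x \<in> carrier U" if "x \<in> carrier (free_module K S)" for x by (rule L_closed[OF that])
  next
    fix x y assume xy: "x \<in> carrier (free_module K S) \<and> y \<in> carrier (free_module K S)"
    define A where "A = {s \<in> S. x s \<noteq> \<zero>\<^bsub>K\<^esub>} \<union> {s \<in> S. y s \<noteq> \<zero>\<^bsub>K\<^esub>}"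
    have A: "finite A" "A \<subseteq> S" using xy by (auto simp: A_def simps)
    have "L (x \<oplus>\<^bsub>free_module K S\<^esub> y) = (\<Oplus>\<^bsub>U\<^esub>s\<in>A. (x \<oplus>\<^bsub>free_module K S\<^esub> y) s \<odot>\<^bsub>U\<^esub> b s)"
      by (rule L_eq) (use xy A in \<open>auto simp: simps A_def PiE_iff\<close>)
    also have "\<dots> = (\<Oplus>\<^bsub>U\<^esub>s\<in>A. x s \<odot>\<^bsub>U\<^esub> b s \<oplus>\<^bsub>U\<^esub> y s \<odot>\<^bsub>U\<^esub> b s)"
      by (rule U.M.finsum_cong') (use xy A b in \<open>auto simp: simps U.smult_l_distr PiE_iff Pi_iff subset_iff\<close>)
    also have "\<dots> = (\<Oplus>\<^bsub>U\<^esub>s\<in>A. x s \<odot>\<^bsub>U\<^esub> b s) \<oplus>\<^bsub>U\<^esub> (\<Oplus>\<^bsub>U\<^esub>s\<in>A. y s \<odot>\<^bsub>U\<^esub> b s)"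
      by (rule U.M.finsum_addf) (use xy A b in \<open>auto simp: simps PiE_iff Pi_iff subset_iff\<close>)
    also have "(\<Oplus>\<^bsub>U\<^esub>s\<in>A. x s \<odot>\<^bsub>U\<^esub> b s) = L x"
      by (rule L_eq[symmetric]) (use xy A in \<open>auto simp: simps A_def PiE_iff\<close>)
    also have "(\<Oplus>\<^bsub>U\<^esub>s\<in>A. y s \<odot>\<^bsub>U\<^esub> b s) = L y"
      by (rule L_eq[symmetric]) (use xy A in \<open>auto simp: simps A_def PiE_iff\<close>)
    finally show "L (x \<oplus>\<^bsub>free_module K S\<^esub> y) = L x \<oplus>\<^bsub>U\<^esub> L y" .
  next
    fix c x assume cx: "c \<in> carrier K \<and> x \<in> carrier (free_module K S)"
    define A where "A = {s \<in> S. x s \<noteq> \<zero>\<^bsub>K\<^esub>}"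
    have A: "finite A" "A \<subseteq> S" using cx by (auto simp: A_def simps)
    have "L (c \<odot>\<^bsub>free_module K S\<^esub> x) = (\<Oplus>\<^bsub>U\<^esub>s\<in>A. (c \<odot>\<^bsub>free_module K S\<^esub> x) s \<odot>\<^bsub>U\<^esub> b s)"
      by (rule L_eq) (use cx A in \<open>auto simp: simps A_def PiE_iff\<close>)
    also have "\<dots> = (\<Oplus>\<^bsub>U\<^esub>s\<in>A. c \<odot>\<^bsub>U\<^esub> (x s \<odot>\<^bsub>U\<^esub> b s))"
      by (rule U.M.finsum_cong') (use cx A b in \<open>auto simp: simps U.smult_assoc1 PiE_iff Pi_iff subset_iff\<close>)
    also have "\<dots> = c \<odot>\<^bsub>U\<^esub> (\<Oplus>\<^bsub>U\<^esub>s\<in>A. x s \<odot>\<^bsub>U\<^esub> b s)"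
      by (rule U.finsum_smult_ldistr[symmetric])
        (use cx A b in \<open>auto simp: simps PiE_iff Pi_iff subset_iff\<close>)
    finally show "L (c \<odot>\<^bsub>free_module K S\<^esub> x) = c \<odot>\<^bsub>U\<^esub> L x" by (simp add: L_def A_def)
  qed
  moreover have "L (free_gen K S s) = b s" if s: "s \<in> S" for s
  proof -
    have "L (free_gen K S s) = (\<Oplus>\<^bsub>U\<^esub>t\<in>{s}. free_gen K S s t \<odot>\<^bsub>U\<^esub> b t)"
      by (rule L_eq) (use s in \<open>auto simp: free_gen_def\<close>)
    also have "\<dots> = b s"
    proof -
      have "free_gen K S s s = \<one>\<^bsub>K\<^esub>" using s by (simp add: free_gen_def)
      moreover have "b s \<in> carrier U" using s b by auto
      ultimately show ?thesis by (subst U.M.finsum_insert) auto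
    qed
    finally show ?thesis .
  qed
  ultimately show ?thesis by blast
qed

lemma submodule_abelian_subgroup:
  assumes "submodule K N M"
  shows "abelian_subgroup N M"
proof -
  interpret submodule K N M by fact
  interpret M: module K M by (rule module)
  have ne: "N \<noteq> {}" using LinearCombinations.submodule.zero_closed[OF assms] by blast
  have "\<ominus>\<^bsub>M\<^esub> x \<in> N" if x: "x \<in> N" for x
  proof -
    have "\<ominus>\<^bsub>K\<^esub> \<one>\<^bsub>K\<^esub> \<in> carrier K" by simp
    from LinearCombinations.submodule.smult_closed[OF assms this x] show ?thesis
      using M.smult_minus_1[of x] subsetD[OF subset x] by metis
  qed
  then have "subgroup N (add_monoid M)"
    by (intro M.M.add.subgroupI) (use subset ne in \<open>auto simp: a_inv_def\<close>)
  then show ?thesis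
    by (rule abelian_subgroupI3[OF additive_subgroup.intro M.abelian_group_axioms])
qed

lemma quotient_module_simps:
  assumes "submodule K N M"
  shows "carrier (quotient_module M N) = (\<lambda>x. N +>\<^bsub>M\<^esub> x) ` carrier M"
    and "\<zero>\<^bsub>quotient_module M N\<^esub> = N +>\<^bsub>M\<^esub> \<zero>\<^bsub>M\<^esub>"
    and "x \<in> carrier M \<Longrightarrow> y \<in> carrier M \<Longrightarrow>
      (N +>\<^bsub>M\<^esub> x) \<oplus>\<^bsub>quotient_module M N\<^esub> (N +>\<^bsub>M\<^esub> y) = N +>\<^bsub>M\<^esub> (x \<oplus>\<^bsub>M\<^esub> y)"
    and "c \<in> carrier K \<Longrightarrow> x \<in> carrier M \<Longrightarrow>
      c \<odot>\<^bsub>quotient_module M N\<^esub> (N +>\<^bsub>M\<^esub> x) = N +>\<^bsub>M\<^esub> (c \<odot>\<^bsub>M\<^esub> x)"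
proof -
  interpret submodule K N M by fact
  interpret M: module K M by (rule module)
  interpret N: abelian_subgroup N M by (rule submodule_abelian_subgroup[OF assms])
  show "carrier (quotient_module M N) = (\<lambda>x. N +>\<^bsub>M\<^esub> x) ` carrier M"
    by (auto simp: quotient_module_def A_RCOSETS_def')
  show "\<zero>\<^bsub>quotient_module M N\<^esub> = N +>\<^bsub>M\<^esub> \<zero>\<^bsub>M\<^esub>"
    using subset by (simp add: quotient_module_def)
  show "x \<in> carrier M \<Longrightarrow> y \<in> carrier M \<Longrightarrow>
      (N +>\<^bsub>M\<^esub> x) \<oplus>\<^bsub>quotient_module M N\<^esub> (N +>\<^bsub>M\<^esub> y) = N +>\<^bsub>M\<^esub> (x \<oplus>\<^bsub>M\<^esub> y)"
    by (simp add: quotient_module_def N.a_rcos_sum)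
  assume c: "c \<in> carrier K" and x: "x \<in> carrier M"
  have "N <+>\<^bsub>M\<^esub> ((\<lambda>x. c \<odot>\<^bsub>M\<^esub> x) ` (N +>\<^bsub>M\<^esub> x)) = N +>\<^bsub>M\<^esub> (c \<odot>\<^bsub>M\<^esub> x)" (is "?L = ?R")
  proof
    show "?L \<subseteq> ?R"
    proof
      fix z assume "z \<in> ?L"
      then obtain n m where nm: "n \<in> N" "m \<in> N" and z: "z = n \<oplus>\<^bsub>M\<^esub> c \<odot>\<^bsub>M\<^esub> (m \<oplus>\<^bsub>M\<^esub> x)"
        by (auto simp: set_add_def' a_r_coset_def')
      have "z = (n \<oplus>\<^bsub>M\<^esub> c \<odot>\<^bsub>M\<^esub> m) \<oplus>\<^bsub>M\<^esub> c \<odot>\<^bsub>M\<^esub> x"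
        using nm c x subset by (auto simp: z M.smult_r_distr M.M.a_assoc subset_iff)
      moreover have "n \<oplus>\<^bsub>M\<^esub> c \<odot>\<^bsub>M\<^esub> m \<in> N" using nm c by auto
      ultimately show "z \<in> ?R" by (auto simp: a_r_coset_def')
    qed
    show "?R \<subseteq> ?L"
    proof
      fix z assume "z \<in> ?R"
      then obtain n where n: "n \<in> N" and z: "z = n \<oplus>\<^bsub>M\<^esub> c \<odot>\<^bsub>M\<^esub> x" by (auto simp: a_r_coset_def')
      have "x \<in> N +>\<^bsub>M\<^esub> x" using x by (rule N.a_rcos_self)
      then show "z \<in> ?L" using n z by (auto simp: set_add_def')
    qed
  qed
  then show "c \<odot>\<^bsub>quotient_module M N\<^esub> (N +>\<^bsub>M\<^esub> x) = N +>\<^bsub>M\<^esub> (c \<odot>\<^bsub>M\<^esub> x)"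
    by (simp add: quotient_module_def)
qed

lemma quotient_module_module:
  assumes "submodule K N M"
  shows "module K (quotient_module M N)"
proof -
  interpret submodule K N M by fact
  interpret M: module K M by (rule module)
  note simps = quotient_module_simps[OF assms]
  show ?thesis
  proof (rule moduleI)
    show "cring K" ..
    show "abelian_group (quotient_module M N)"
    proof (rule abelian_groupI)
      fix X Y assume "X \<in> carrier (quotient_module M N)" "Y \<in> carrier (quotient_module M N)"
      then obtain x y where "x \<in> carrier M" "X = N +>\<^bsub>M\<^esub> x" "y \<in> carrier M" "Y = N +>\<^bsub>M\<^esub> y"
        by (auto simp: simps)
      then show "X \<oplus>\<^bsub>quotient_module M N\<^esub> Y = Y \<oplus>\<^bsub>quotient_module M N\<^esub> X"
        by (simp add: simps M.M.a_comm)
    next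
      fix X assume "X \<in> carrier (quotient_module M N)"
      then obtain x where x: "x \<in> carrier M" "X = N +>\<^bsub>M\<^esub> x" by (auto simp: simps)
      then have "(N +>\<^bsub>M\<^esub> (\<ominus>\<^bsub>M\<^esub> x)) \<oplus>\<^bsub>quotient_module M N\<^esub> X = \<zero>\<^bsub>quotient_module M N\<^esub>"
        by (simp add: simps M.M.l_neg)
      then show "\<exists>Y\<in>carrier (quotient_module M N). Y \<oplus>\<^bsub>quotient_module M N\<^esub> X = \<zero>\<^bsub>quotient_module M N\<^esub>"
        using x by (auto simp: simps(1))
    qed (auto simp: simps M.M.a_assoc)
  qed (auto simp: simps M.smult_l_distr M.smult_r_distr M.smult_assoc1)
qed

lemma quotient_map_hom:
  assumes "submodule K N M"
  shows "(\<lambda>x. N +>\<^bsub>M\<^esub> x) \<in> module_hom K M (quotient_module M N)"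
  using quotient_module_simps[OF assms] by (auto simp: module_hom_def)

lemma quotient_module_lift:
  assumes N: "submodule K N M" and U: "module K U" and f: "f \<in> module_hom K M U"
    and ker: "\<And>n. n \<in> N \<Longrightarrow> f n = \<zero>\<^bsub>U\<^esub>"
  shows "\<exists>h \<in> module_hom K (quotient_module M N) U. \<forall>x \<in> carrier M. h (N +>\<^bsub>M\<^esub> x) = f x"
proof -
  interpret submodule K N M by fact
  interpret M: module K M by (rule module)
  interpret U: module K U by fact
  interpret f: mod_hom K M U f by unfold_locales (rule f)
  interpret N: abelian_subgroup N M by (rule submodule_abelian_subgroup[OF N])
  note simps = quotient_module_simps[OF N]
  define h where "h X = f (SOME x. x \<in> X)" for X
  have h: "h (N +>\<^bsub>M\<^esub> x) = f x" if x: "x \<in> carrier M" for x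
  proof -
    have "(SOME y. y \<in> N +>\<^bsub>M\<^esub> x) \<in> N +>\<^bsub>M\<^esub> x" using N.a_rcos_self[OF x] by (rule someI)
    then obtain n where "n \<in> N" "(SOME y. y \<in> N +>\<^bsub>M\<^esub> x) = n \<oplus>\<^bsub>M\<^esub> x" by (auto simp: a_r_coset_def')
    then show ?thesis using x subset ker by (auto simp: h_def)
  qed
  have "h \<in> module_hom K (quotient_module M N) U"
    by (auto simp: module_hom_def simps h)
  then show ?thesis using h by blast
qed

lemma tensor_relations_subset:
  assumes "module K V" "module K W"
  shows "tensor_relations K V W \<subseteq> carrier (tensor_free K V W)"
proof -
  interpret V: module K V by fact
  interpret W: module K W by fact
  have K: "cring K" ..
  interpret F: module K "tensor_free K V W" by (rule free_module_module[OF K])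
  show ?thesis
    by (auto simp: tensor_relations_def Let_def free_gen_closed[OF K]
        intro!: F.M.minus_closed F.M.a_closed F.smult_closed)
qed

lemma tensor_kernel_submodule:
  assumes "module K V" "module K W"
  shows "submodule K (tensor_kernel K V W) (tensor_free K V W)"
proof -
  interpret V: module K V by fact
  have K: "cring K" ..
  interpret F: module K "tensor_free K V W" by (rule free_module_module[OF K])
  show ?thesis
    unfolding tensor_kernel_def by (rule F.span_is_submodule[OF tensor_relations_subset[OF assms]])
qed

lemma tensor_module:
  assumes "module K V" "module K W"
  shows "module K (tensor K V W)"
  unfolding tensor_def by (rule quotient_module_module[OF tensor_kernel_submodule[OF assms]])

lemma tensor_vectorspace:
  assumes "vectorspace K V" "vectorspace K W"
  shows "vectorspace K (tensor K V W)"
  using assms by (auto simp: vectorspace_def intro: tensor_module)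

lemma pure_tensor_closed:
  assumes "module K V" "module K W" "v \<in> carrier V" "w \<in> carrier W"
  shows "pure_tensor K V W v w \<in> carrier (tensor K V W)"
proof -
  interpret V: module K V by fact
  have K: "cring K" ..
  show ?thesis
    using free_gen_closed[OF K, of "(v, w)" "carrier V \<times> carrier W"] assms
    by (auto simp: pure_tensor_def tensor_def quotient_module_simps[OF tensor_kernel_submodule])
qed

lemma pure_tensor_bilinear:
  assumes V: "module K V" and W: "module K W"
  shows "bilinear_map K V W (tensor K V W) (pure_tensor K V W)"
proof -
  interpret V: module K V by fact
  interpret W: module K W by fact
  have K: "cring K" ..
  interpret F: module K "tensor_free K V W" by (rule free_module_module[OF K])
  note N = tensor_kernel_submodule[OF V W]
  interpret N: abelian_subgroup "tensor_kernel K V W" "tensor_free K V W"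
    by (rule submodule_abelian_subgroup[OF N])
  note simps = quotient_module_simps[OF N]
  note gen = free_gen_closed[OF K, of "(v, w)" "carrier V \<times> carrier W" for v w]
  have rel: "tensor_kernel K V W +>\<^bsub>tensor_free K V W\<^esub> x = tensor_kernel K V W +>\<^bsub>tensor_free K V W\<^esub> y"
    if "x \<in> carrier (tensor_free K V W)" "y \<in> carrier (tensor_free K V W)"
      "x \<ominus>\<^bsub>tensor_free K V W\<^esub> y \<in> tensor_relations K V W" for x y
  proof -
    have "x \<ominus>\<^bsub>tensor_free K V W\<^esub> y \<in> tensor_kernel K V W"
      using that F.in_own_span[OF tensor_relations_subset[OF V W]] by (auto simp: tensor_kernel_def)
    moreover have "x = (x \<ominus>\<^bsub>tensor_free K V W\<^esub> y) \<oplus>\<^bsub>tensor_free K V W\<^esub> y"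
      using that by (simp add: a_minus_def F.M.a_assoc F.M.l_neg)
    ultimately have "x \<in> tensor_kernel K V W +>\<^bsub>tensor_free K V W\<^esub> y"
      by (force simp: a_r_coset_def')
    then show ?thesis
      using that N.a_subgroup N.a_subset by (intro F.M.a_repr_independence[symmetric]) auto
  qed
  show ?thesis
    unfolding bilinear_map_def
  proof (intro conjI ballI)
    fix v assume v: "v \<in> carrier V"
    show "pure_tensor K V W v \<in> module_hom K W (tensor K V W)"
      unfolding module_hom_def
    proof (intro CollectI conjI allI impI funcsetI)
      fix w w' assume w: "w \<in> carrier W \<and> w' \<in> carrier W"
      have "pure_tensor K V W v (w \<oplus>\<^bsub>W\<^esub> w') =
          tensor_kernel K V W +>\<^bsub>tensor_free K V W\<^esub> (free_gen K (carrier V \<times> carrier W) (v, w) \<oplus>\<^bsub>tensor_free K V W\<^esub> free_gen K (carrier V \<times> carrier W) (v, w'))"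
        unfolding pure_tensor_def
      proof (rule rel)
        show "free_gen K (carrier V \<times> carrier W) (v, w \<oplus>\<^bsub>W\<^esub> w') \<ominus>\<^bsub>tensor_free K V W\<^esub>
            (free_gen K (carrier V \<times> carrier W) (v, w) \<oplus>\<^bsub>tensor_free K V W\<^esub> free_gen K (carrier V \<times> carrier W) (v, w')) \<in> tensor_relations K V W"
          using v w unfolding tensor_relations_def Let_def by blast
      qed (use v w in \<open>auto simp: gen\<close>)
      then show "pure_tensor K V W v (w \<oplus>\<^bsub>W\<^esub> w') = pure_tensor K V W v w \<oplus>\<^bsub>tensor K V W\<^esub> pure_tensor K V W v w'"
        using v w by (simp add: pure_tensor_def tensor_def simps gen)
    next
      fix c w assume w: "c \<in> carrier K \<and> w \<in> carrier W"
      have "pure_tensor K V W v (c \<odot>\<^bsub>W\<^esub> w) =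
          tensor_kernel K V W +>\<^bsub>tensor_free K V W\<^esub> (c \<odot>\<^bsub>tensor_free K V W\<^esub> free_gen K (carrier V \<times> carrier W) (v, w))"
        unfolding pure_tensor_def
      proof (rule rel)
        show "free_gen K (carrier V \<times> carrier W) (v, c \<odot>\<^bsub>W\<^esub> w) \<ominus>\<^bsub>tensor_free K V W\<^esub>
            (c \<odot>\<^bsub>tensor_free K V W\<^esub> free_gen K (carrier V \<times> carrier W) (v, w)) \<in> tensor_relations K V W"
          using v w unfolding tensor_relations_def Let_def by blast
      qed (use v w in \<open>auto simp: gen\<close>)
      then show "pure_tensor K V W v (c \<odot>\<^bsub>W\<^esub> w) = c \<odot>\<^bsub>tensor K V W\<^esub> pure_tensor K V W v w"
        using v w by (simp add: pure_tensor_def tensor_def simps gen)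
    qed (use v pure_tensor_closed[OF V W] in auto)
  next
    fix w assume w: "w \<in> carrier W"
    show "(\<lambda>v. pure_tensor K V W v w) \<in> module_hom K V (tensor K V W)"
      unfolding module_hom_def
    proof (intro CollectI conjI allI impI funcsetI)
      fix v v' assume v: "v \<in> carrier V \<and> v' \<in> carrier V"
      have "pure_tensor K V W (v \<oplus>\<^bsub>V\<^esub> v') w =
          tensor_kernel K V W +>\<^bsub>tensor_free K V W\<^esub> (free_gen K (carrier V \<times> carrier W) (v, w) \<oplus>\<^bsub>tensor_free K V W\<^esub> free_gen K (carrier V \<times> carrier W) (v', w))"
        unfolding pure_tensor_def
      proof (rule rel)
        show "free_gen K (carrier V \<times> carrier W) (v \<oplus>\<^bsub>V\<^esub> v', w) \<ominus>\<^bsub>tensor_free K V W\<^esub>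
            (free_gen K (carrier V \<times> carrier W) (v, w) \<oplus>\<^bsub>tensor_free K V W\<^esub> free_gen K (carrier V \<times> carrier W) (v', w)) \<in> tensor_relations K V W"
          using v w unfolding tensor_relations_def Let_def by blast
      qed (use v w in \<open>auto simp: gen\<close>)
      then show "pure_tensor K V W (v \<oplus>\<^bsub>V\<^esub> v') w = pure_tensor K V W v w \<oplus>\<^bsub>tensor K V W\<^esub> pure_tensor K V W v' w"
        using v w by (simp add: pure_tensor_def tensor_def simps gen)
    next
      fix c v assume v: "c \<in> carrier K \<and> v \<in> carrier V"
      have "pure_tensor K V W (c \<odot>\<^bsub>V\<^esub> v) w =
          tensor_kernel K V W +>\<^bsub>tensor_free K V W\<^esub> (c \<odot>\<^bsub>tensor_free K V W\<^esub> free_gen K (carrier V \<times> carrier W) (v, w))"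
        unfolding pure_tensor_def
      proof (rule rel)
        show "free_gen K (carrier V \<times> carrier W) (c \<odot>\<^bsub>V\<^esub> v, w) \<ominus>\<^bsub>tensor_free K V W\<^esub>
            (c \<odot>\<^bsub>tensor_free K V W\<^esub> free_gen K (carrier V \<times> carrier W) (v, w)) \<in> tensor_relations K V W"
          using v w unfolding tensor_relations_def Let_def by blast
      qed (use v w in \<open>auto simp: gen\<close>)
      then show "pure_tensor K V W (c \<odot>\<^bsub>V\<^esub> v) w = c \<odot>\<^bsub>tensor K V W\<^esub> pure_tensor K V W v w"
        using v w by (simp add: pure_tensor_def tensor_def simps gen)
    qed (use w pure_tensor_closed[OF V W] in auto)
  qed
qed

lemma tensor_hom_eq:
  assumes V: "module K V" and W: "module K W" and U: "module K U"
    and f: "f \<in> module_hom K (tensor K V W) U" and g: "g \<in> module_hom K (tensor K V W) U"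
    and eq: "\<And>v w. v \<in> carrier V \<Longrightarrow> w \<in> carrier W \<Longrightarrow>
      f (pure_tensor K V W v w) = g (pure_tensor K V W v w)"
    and x: "x \<in> carrier (tensor K V W)"
  shows "f x = g x"
proof -
  note N = tensor_kernel_submodule[OF V W]
  note simps = quotient_module_simps[OF N]
  let ?q = "\<lambda>x. tensor_kernel K V W +>\<^bsub>tensor_free K V W\<^esub> x"
  have q: "?q \<in> module_hom K (tensor_free K V W) (tensor K V W)"
    unfolding tensor_def by (rule quotient_map_hom[OF N])
  have hom: "(\<lambda>x. h (?q x)) \<in> module_hom K (tensor_free K V W) U"
    if "h \<in> module_hom K (tensor K V W) U" for h
    using that q by (auto simp: module_hom_def Pi_iff)
  obtain y where y: "y \<in> carrier (tensor_free K V W)" "x = ?q y"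
    using x by (auto simp: tensor_def simps)
  have "f (?q y) = g (?q y)"
    by (rule free_module_hom_eq[OF U hom[OF f] hom[OF g] _ y(1)])
      (auto simp: eq[unfolded pure_tensor_def])
  then show ?thesis using y by simp
qed

lemma tensor_universal:
  assumes V: "module K V" and W: "module K W" and U: "module K U" and B: "bilinear_map K V W U B"
  shows "\<exists>!h. h \<in> module_hom K (tensor K V W) U \<inter> extensional (carrier (tensor K V W)) \<and>
    (\<forall>v \<in> carrier V. \<forall>w \<in> carrier W. h (pure_tensor K V W v w) = B v w)"
proof -
  interpret V: module K V by fact
  interpret W: module K W by fact
  interpret U: module K U by fact
  have K: "cring K" ..
  interpret F: module K "tensor_free K V W" by (rule free_module_module[OF K])
  interpret T: module K "tensor K V W" by (rule tensor_module[OF V W])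
  note N = tensor_kernel_submodule[OF V W]
  note gen = free_gen_closed[OF K, of "(v, w)" "carrier V \<times> carrier W" for v w]
  have Bc: "B v w \<in> carrier U" if "v \<in> carrier V" "w \<in> carrier W" for v w
    using B that by (auto simp: bilinear_map_def module_hom_def)
  obtain L where L: "L \<in> module_hom K (tensor_free K V W) U"
    and Lgen: "\<And>v w. v \<in> carrier V \<Longrightarrow> w \<in> carrier W \<Longrightarrow>
      L (free_gen K (carrier V \<times> carrier W) (v, w)) = B v w"
  proof -
    have "case_prod B \<in> carrier V \<times> carrier W \<rightarrow> carrier U" using Bc by auto
    from free_module_hom_ex[OF U this] show ?thesis using that by auto
  qed
  interpret L: mod_hom K "tensor_free K V W" U L by unfold_locales (rule L)
  have Badd1: "B (v \<oplus>\<^bsub>V\<^esub> v') w = B v w \<oplus>\<^bsub>U\<^esub> B v' w"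
    if "v \<in> carrier V" "v' \<in> carrier V" "w \<in> carrier W" for v v' w
    using B that by (auto simp: bilinear_map_def module_hom_def)
  have Badd2: "B v (w \<oplus>\<^bsub>W\<^esub> w') = B v w \<oplus>\<^bsub>U\<^esub> B v w'"
    if "v \<in> carrier V" "w \<in> carrier W" "w' \<in> carrier W" for v w w'
    using B that by (auto simp: bilinear_map_def module_hom_def)
  have Bsm1: "B (c \<odot>\<^bsub>V\<^esub> v) w = c \<odot>\<^bsub>U\<^esub> B v w"
    if "v \<in> carrier V" "c \<in> carrier K" "w \<in> carrier W" for v c w
    using B that by (auto simp: bilinear_map_def module_hom_def)
  have Bsm2: "B v (c \<odot>\<^bsub>W\<^esub> w) = c \<odot>\<^bsub>U\<^esub> B v w"
    if "v \<in> carrier V" "c \<in> carrier K" "w \<in> carrier W" for v c w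
    using B that by (auto simp: bilinear_map_def module_hom_def)
  have "tensor_relations K V W \<subseteq> L.ker"
    using tensor_relations_subset[OF V W]
    by (auto simp: L.ker_def tensor_relations_def Let_def gen Lgen Badd1 Badd2 Bsm1 Bsm2 Bc)
  then have "tensor_kernel K V W \<subseteq> L.ker"
    unfolding tensor_kernel_def by (rule F.span_is_subset[OF _ L.ker_is_submodule])
  then have ker: "L n = \<zero>\<^bsub>U\<^esub>" if "n \<in> tensor_kernel K V W" for n
    using that by (auto simp: L.ker_def)
  obtain h where h: "h \<in> module_hom K (tensor K V W) U"
    and hL: "\<And>x. x \<in> carrier (tensor_free K V W) \<Longrightarrow>
      h (tensor_kernel K V W +>\<^bsub>tensor_free K V W\<^esub> x) = L x"
    using quotient_module_lift[OF N U L ker] by (auto simp: tensor_def)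
  have hB: "h (pure_tensor K V W v w) = B v w" if "v \<in> carrier V" "w \<in> carrier W" for v w
    using that by (simp add: pure_tensor_def hL gen Lgen)
  let ?h = "restrict h (carrier (tensor K V W))"
  have "?h \<in> module_hom K (tensor K V W) U"
    using h by (auto simp: module_hom_def)
  moreover have "?h (pure_tensor K V W v w) = B v w" if "v \<in> carrier V" "w \<in> carrier W" for v w
    using that by (simp add: hB pure_tensor_closed[OF V W])
  moreover have "g = ?h"
    if g: "g \<in> module_hom K (tensor K V W) U" "g \<in> extensional (carrier (tensor K V W))"
      and gB: "\<forall>v \<in> carrier V. \<forall>w \<in> carrier W. g (pure_tensor K V W v w) = B v w" for g
  proof (rule extensionalityI[OF g(2) restrict_extensional])
    fix x assume x: "x \<in> carrier (tensor K V W)"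
    have "g x = h x"
      by (rule tensor_hom_eq[OF V W U g(1) h _ x]) (simp add: gB hB)
    then show "g x = ?h x" using x by simp
  qed
  ultimately show ?thesis
    using restrict_extensional[of h "carrier (tensor K V W)"] by (intro ex1I[of _ ?h]) blast+
qed

lemma tensor_lift:
  assumes "module K V" "module K W" "module K U" "bilinear_map K V W U B"
  shows "tensor_lift K V W U B \<in> module_hom K (tensor K V W) U"
    and "v \<in> carrier V \<Longrightarrow> w \<in> carrier W \<Longrightarrow>
      tensor_lift K V W U B (pure_tensor K V W v w) = B v w"
  using theI'[OF tensor_universal[OF assms], folded tensor_lift_def] by blast+


lemma pure_tensor_hom:
  assumes "module K V" "module K W"
  shows "v \<in> carrier V \<Longrightarrow> pure_tensor K V W v \<in> module_hom K W (tensor K V W)"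
    and "w \<in> carrier W \<Longrightarrow> (\<lambda>v. pure_tensor K V W v w) \<in> module_hom K V (tensor K V W)"
  using pure_tensor_bilinear[OF assms] unfolding bilinear_map_def by blast+

lemma module_hom_comp:
  assumes "f \<in> module_hom K U V" "g \<in> module_hom K V W"
  shows "(\<lambda>x. g (f x)) \<in> module_hom K U W"
  using assms by (auto simp: module_hom_def Pi_iff)

lemma module_hom_plus:
  assumes "module K V" "f \<in> module_hom K U V" "g \<in> module_hom K U V"
  shows "(\<lambda>x. f x \<oplus>\<^bsub>V\<^esub> g x) \<in> module_hom K U V"
proof -
  interpret V: module K V by fact
  show ?thesis
    using assms(2,3) by (auto simp: module_hom_def Pi_iff V.smult_r_distr V.M.a_ac)
qed

lemma module_hom_scale:
  assumes "module K V" "f \<in> module_hom K U V" "c \<in> carrier K"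
  shows "(\<lambda>x. c \<odot>\<^bsub>V\<^esub> f x) \<in> module_hom K U V"
proof -
  interpret V: module K V by fact
  have "c \<odot>\<^bsub>V\<^esub> (r \<odot>\<^bsub>V\<^esub> y) = r \<odot>\<^bsub>V\<^esub> (c \<odot>\<^bsub>V\<^esub> y)" if "r \<in> carrier K" "y \<in> carrier V" for r y
    using that assms(3) by (simp add: V.smult_assoc1[symmetric] V.R.m_comm)
  then show ?thesis
    using assms(2,3) by (auto simp: module_hom_def Pi_iff V.smult_r_distr)
qed

text \<open>A family of bilinear maps that is linear in a parameter \<open>y\<close> induces a family of
  linear maps that is linear in \<open>y\<close>.\<close>

lemma tensor_lift_param:
  assumes V: "module K V" and W: "module K W" and Y: "module K Y" and U: "module K U"
    and B: "\<And>y. y \<in> carrier Y \<Longrightarrow> bilinear_map K V W U (B y)"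
    and lin: "\<And>v w. v \<in> carrier V \<Longrightarrow> w \<in> carrier W \<Longrightarrow> (\<lambda>y. B y v w) \<in> module_hom K Y U"
    and x: "x \<in> carrier (tensor K V W)"
  shows "(\<lambda>y. tensor_lift K V W U (B y) x) \<in> module_hom K Y U"
proof -
  interpret Y: module K Y by fact
  note lift = tensor_lift[OF V W U B]
  show ?thesis
    unfolding module_hom_def
  proof (intro CollectI conjI allI impI funcsetI)
    fix y assume "y \<in> carrier Y"
    then show "tensor_lift K V W U (B y) x \<in> carrier U"
      using module_hom_closed[OF lift(1)] x by blast
  next
    fix y z assume yz: "y \<in> carrier Y \<and> z \<in> carrier Y"
    show "tensor_lift K V W U (B (y \<oplus>\<^bsub>Y\<^esub> z)) x =
      tensor_lift K V W U (B y) x \<oplus>\<^bsub>U\<^esub> tensor_lift K V W U (B z) x"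
      by (rule tensor_hom_eq[OF V W U _ _ _ x])
        (use yz lift(2) module_hom_add[OF lin] in \<open>auto intro!: lift(1) module_hom_plus[OF U]\<close>)
  next
    fix c y assume cy: "c \<in> carrier K \<and> y \<in> carrier Y"
    show "tensor_lift K V W U (B (c \<odot>\<^bsub>Y\<^esub> y)) x = c \<odot>\<^bsub>U\<^esub> tensor_lift K V W U (B y) x"
      by (rule tensor_hom_eq[OF V W U _ _ _ x])
        (use cy lift(2) module_hom_smult[OF lin] in \<open>auto intro!: lift(1) module_hom_scale[OF U]\<close>)
  qed
qed

lemma tensor_map:
  assumes V: "module K V" and W: "module K W" and V': "module K V'" and W': "module K W'"
    and f: "f \<in> module_hom K V V'" and g: "g \<in> module_hom K W W'"
  shows "tensor_map K V W V' W' f g \<in> module_hom K (tensor K V W) (tensor K V' W')"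
    and "v \<in> carrier V \<Longrightarrow> w \<in> carrier W \<Longrightarrow>
      tensor_map K V W V' W' f g (pure_tensor K V W v w) = pure_tensor K V' W' (f v) (g w)"
proof -
  have B: "bilinear_map K V W (tensor K V' W') (\<lambda>v w. pure_tensor K V' W' (f v) (g w))"
    using f g unfolding bilinear_map_def
    by (auto intro!: module_hom_comp[OF g] pure_tensor_hom[OF V' W'] 
        module_hom_comp[OF f, of "\<lambda>x. pure_tensor K V' W' x y" for y] simp: module_hom_closed[THEN funcset_mem])
  show "tensor_map K V W V' W' f g \<in> module_hom K (tensor K V W) (tensor K V' W')"
    and "v \<in> carrier V \<Longrightarrow> w \<in> carrier W \<Longrightarrow>
      tensor_map K V W V' W' f g (pure_tensor K V W v w) = pure_tensor K V' W' (f v) (g w)"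
    using tensor_lift[OF V W tensor_module[OF V' W'] B] by (auto simp: tensor_map_def)
qed

lemma tensor_assoc:
  assumes U: "module K U" and V: "module K V" and W: "module K W"
  shows "tensor_assoc K U V W
      \<in> module_hom K (tensor K (tensor K U V) W) (tensor K U (tensor K V W))"
    and "u \<in> carrier U \<Longrightarrow> v \<in> carrier V \<Longrightarrow> w \<in> carrier W \<Longrightarrow>
      tensor_assoc K U V W (pure_tensor K (tensor K U V) W (pure_tensor K U V u v) w) =
      pure_tensor K U (tensor K V W) u (pure_tensor K V W v w)"
proof -
  note VW = tensor_module[OF V W] and UV = tensor_module[OF U V]
  note Y = tensor_module[OF U VW]
  let ?b = "\<lambda>w u v. pure_tensor K U (tensor K V W) u (pure_tensor K V W v w)"
  have lin_w: "(\<lambda>w. ?b w u v) \<in> module_hom K W (tensor K U (tensor K V W))"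
    if "u \<in> carrier U" "v \<in> carrier V" for u v
    using module_hom_comp[OF pure_tensor_hom(1)[OF V W that(2)] pure_tensor_hom(1)[OF U VW that(1)]] .
  have b: "bilinear_map K U V (tensor K U (tensor K V W)) (?b w)" if w: "w \<in> carrier W" for w
    unfolding bilinear_map_def
    using module_hom_comp[OF pure_tensor_hom(2)[OF V W w] pure_tensor_hom(1)[OF U VW]]
      pure_tensor_hom(2)[OF U VW] pure_tensor_closed[OF V W _ w] by auto
  let ?B = "\<lambda>x w. tensor_lift K U V (tensor K U (tensor K V W)) (?b w) x"
  have B: "bilinear_map K (tensor K U V) W (tensor K U (tensor K V W)) ?B"
    unfolding bilinear_map_def
    using tensor_lift_param[OF U V W Y b lin_w] tensor_lift(1)[OF U V Y b] by auto
  note lift = tensor_lift[OF UV W Y B]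
  show "tensor_assoc K U V W
      \<in> module_hom K (tensor K (tensor K U V) W) (tensor K U (tensor K V W))"
    using lift(1) by (simp add: tensor_assoc_def Let_def)
  show "u \<in> carrier U \<Longrightarrow> v \<in> carrier V \<Longrightarrow> w \<in> carrier W \<Longrightarrow>
      tensor_assoc K U V W (pure_tensor K (tensor K U V) W (pure_tensor K U V u v) w) =
      pure_tensor K U (tensor K V W) u (pure_tensor K V W v w)"
    using lift(2) tensor_lift(2)[OF U V Y b] pure_tensor_closed[OF U V]
    by (simp add: tensor_assoc_def Let_def)
qed

lemma tensor_assoc_inv:
  assumes U: "module K U" and V: "module K V" and W: "module K W"
  shows "tensor_assoc_inv K U V W
      \<in> module_hom K (tensor K U (tensor K V W)) (tensor K (tensor K U V) W)"
    and "u \<in> carrier U \<Longrightarrow> v \<in> carrier V \<Longrightarrow> w \<in> carrier W \<Longrightarrow>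
      tensor_assoc_inv K U V W (pure_tensor K U (tensor K V W) u (pure_tensor K V W v w)) =
      pure_tensor K (tensor K U V) W (pure_tensor K U V u v) w"
proof -
  note VW = tensor_module[OF V W] and UV = tensor_module[OF U V]
  note X = tensor_module[OF UV W]
  let ?b = "\<lambda>u v w. pure_tensor K (tensor K U V) W (pure_tensor K U V u v) w"
  have lin_u: "(\<lambda>u. ?b u v w) \<in> module_hom K U (tensor K (tensor K U V) W)"
    if "v \<in> carrier V" "w \<in> carrier W" for v w
    using module_hom_comp[OF pure_tensor_hom(2)[OF U V that(1)] pure_tensor_hom(2)[OF UV W that(2)]] .
  have b: "bilinear_map K V W (tensor K (tensor K U V) W) (?b u)" if u: "u \<in> carrier U" for u
    unfolding bilinear_map_def
    using module_hom_comp[OF pure_tensor_hom(1)[OF U V u] pure_tensor_hom(2)[OF UV W]]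
      pure_tensor_hom(1)[OF UV W] pure_tensor_closed[OF U V u] by auto
  let ?B = "\<lambda>u. tensor_lift K V W (tensor K (tensor K U V) W) (?b u)"
  have B: "bilinear_map K U (tensor K V W) (tensor K (tensor K U V) W) ?B"
    unfolding bilinear_map_def
    using tensor_lift_param[OF V W U X b lin_u] tensor_lift(1)[OF V W X b] by auto
  note lift = tensor_lift[OF U VW X B]
  show "tensor_assoc_inv K U V W
      \<in> module_hom K (tensor K U (tensor K V W)) (tensor K (tensor K U V) W)"
    using lift(1) by (simp add: tensor_assoc_inv_def Let_def)
  show "u \<in> carrier U \<Longrightarrow> v \<in> carrier V \<Longrightarrow> w \<in> carrier W \<Longrightarrow>
      tensor_assoc_inv K U V W (pure_tensor K U (tensor K V W) u (pure_tensor K V W v w)) =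
      pure_tensor K (tensor K U V) W (pure_tensor K U V u v) w"
    using lift(2) tensor_lift(2)[OF V W X b] pure_tensor_closed[OF V W]
    by (simp add: tensor_assoc_inv_def Let_def)
qed


section \<open>Maps between tensor powers of one space\<close>

text \<open>\<open>D \<otimes> D \<otimes> D\<close> is read as \<open>(D \<otimes> D) \<otimes> D\<close>. A map whose natural (co)domain
  is \<open>D \<otimes> (D \<otimes> D)\<close> is transported along the associativity isomorphism. The digits in the names
  count tensor factors: e.g. \<open>tensor_map_12_11\<close> forms \<open>f \<otimes> g\<close> with \<open>f : D \<rightarrow> D\<close> and
  \<open>g : D \<otimes> D \<rightarrow> D\<close>.\<close>

definition tensor2 :: "('k, 'r) ring_scheme \<Rightarrow> ('k, 'd, 'm) module_scheme
    \<Rightarrow> ('k, ('d \<times> 'd \<Rightarrow> 'k) set) module" where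
  "tensor2 K D = tensor K D D"

definition tensor3 :: "('k, 'r) ring_scheme \<Rightarrow> ('k, 'd, 'm) module_scheme
    \<Rightarrow> ('k, (('d \<times> 'd \<Rightarrow> 'k) set \<times> 'd \<Rightarrow> 'k) set) module" where
  "tensor3 K D = tensor K (tensor2 K D) D"

definition tensor_map_11_11 :: "('k, 'r) ring_scheme \<Rightarrow> ('k, 'd, 'm) module_scheme
    \<Rightarrow> ('d \<Rightarrow> 'd) \<Rightarrow> ('d \<Rightarrow> 'd) \<Rightarrow> ('d \<times> 'd \<Rightarrow> 'k) set \<Rightarrow> ('d \<times> 'd \<Rightarrow> 'k) set" where
  "tensor_map_11_11 K D f g = tensor_map K D D D D f g"

definition tensor_map_12_11 :: "('k, 'r) ring_scheme \<Rightarrow> ('k, 'd, 'm) module_scheme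
    \<Rightarrow> ('d \<Rightarrow> 'd) \<Rightarrow> (('d \<times> 'd \<Rightarrow> 'k) set \<Rightarrow> 'd)
    \<Rightarrow> (('d \<times> 'd \<Rightarrow> 'k) set \<times> 'd \<Rightarrow> 'k) set \<Rightarrow> ('d \<times> 'd \<Rightarrow> 'k) set" where
  "tensor_map_12_11 K D f g = tensor_map K D (tensor2 K D) D D f g \<circ> tensor_assoc K D D D"

definition tensor_map_21_11 :: "('k, 'r) ring_scheme \<Rightarrow> ('k, 'd, 'm) module_scheme
    \<Rightarrow> (('d \<times> 'd \<Rightarrow> 'k) set \<Rightarrow> 'd) \<Rightarrow> ('d \<Rightarrow> 'd)
    \<Rightarrow> (('d \<times> 'd \<Rightarrow> 'k) set \<times> 'd \<Rightarrow> 'k) set \<Rightarrow> ('d \<times> 'd \<Rightarrow> 'k) set" where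
  "tensor_map_21_11 K D f g = tensor_map K (tensor2 K D) D D D f g"

definition tensor_map_12_12 :: "('k, 'r) ring_scheme \<Rightarrow> ('k, 'd, 'm) module_scheme
    \<Rightarrow> ('d \<Rightarrow> 'd) \<Rightarrow> (('d \<times> 'd \<Rightarrow> 'k) set \<Rightarrow> ('d \<times> 'd \<Rightarrow> 'k) set)
    \<Rightarrow> (('d \<times> 'd \<Rightarrow> 'k) set \<times> 'd \<Rightarrow> 'k) set \<Rightarrow> (('d \<times> 'd \<Rightarrow> 'k) set \<times> 'd \<Rightarrow> 'k) set" where
  "tensor_map_12_12 K D f g =
     tensor_assoc_inv K D D D \<circ> tensor_map K D (tensor2 K D) D (tensor2 K D) f g
       \<circ> tensor_assoc K D D D"

definition tensor_map_21_21 :: "('k, 'r) ring_scheme \<Rightarrow> ('k, 'd, 'm) module_scheme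
    \<Rightarrow> (('d \<times> 'd \<Rightarrow> 'k) set \<Rightarrow> ('d \<times> 'd \<Rightarrow> 'k) set) \<Rightarrow> ('d \<Rightarrow> 'd)
    \<Rightarrow> (('d \<times> 'd \<Rightarrow> 'k) set \<times> 'd \<Rightarrow> 'k) set \<Rightarrow> (('d \<times> 'd \<Rightarrow> 'k) set \<times> 'd \<Rightarrow> 'k) set" where
  "tensor_map_21_21 K D f g = tensor_map K (tensor2 K D) D (tensor2 K D) D f g"


section \<open>BiHom-associative algebras\<close>

abbreviation product_of :: "('k, 'r) ring_scheme \<Rightarrow> ('k, 'd, 'm) module_scheme
    \<Rightarrow> (('d \<times> 'd \<Rightarrow> 'k) set \<Rightarrow> 'd) \<Rightarrow> 'd \<Rightarrow> 'd \<Rightarrow> 'd" where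
  "product_of K D \<mu> a b \<equiv> \<mu> (pure_tensor K D D a b)"

definition multiplicative :: "('k, 'r) ring_scheme \<Rightarrow> ('k, 'd, 'm) module_scheme
    \<Rightarrow> (('d \<times> 'd \<Rightarrow> 'k) set \<Rightarrow> 'd) \<Rightarrow> ('d \<Rightarrow> 'd) \<Rightarrow> bool" where
  "multiplicative K D \<mu> f \<longleftrightarrow>
     (\<forall>a \<in> carrier D. \<forall>b \<in> carrier D. f (product_of K D \<mu> a b) = product_of K D \<mu> (f a) (f b))"

definition commute_on :: "'a set \<Rightarrow> ('a \<Rightarrow> 'a) \<Rightarrow> ('a \<Rightarrow> 'a) \<Rightarrow> bool" where
  "commute_on A f g \<longleftrightarrow> (\<forall>x \<in> A. f (g x) = g (f x))"

locale bihom_associative_algebra = vectorspace K A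
  for K :: "('k, 'r) ring_scheme" and A :: "('k, 'a, 'm) module_scheme" +
  fixes \<mu> :: "('a \<times> 'a \<Rightarrow> 'k) set \<Rightarrow> 'a" and \<alpha> \<beta> :: "'a \<Rightarrow> 'a"
  assumes mu_linear: "\<mu> \<in> module_hom K (tensor2 K A) A"
    and alpha_linear: "\<alpha> \<in> module_hom K A A"
    and beta_linear: "\<beta> \<in> module_hom K A A"
    and alpha_beta_commute: "commute_on (carrier A) \<alpha> \<beta>"
    and alpha_mult: "multiplicative K A \<mu> \<alpha>"
    and beta_mult: "multiplicative K A \<mu> \<beta>"
    and bihom_assoc:
      "\<lbrakk>a \<in> carrier A; a' \<in> carrier A; a'' \<in> carrier A\<rbrakk> \<Longrightarrow>
        product_of K A \<mu> (\<alpha> a) (product_of K A \<mu> a' a'') =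
        product_of K A \<mu> (product_of K A \<mu> a a') (\<beta> a'')"

end

theory Submission
  imports Defs
begin

text \<open>Both sides of the BiHom-associativity law of \<open>\<mu> \<circ> T\<close> are values of maps on
  \<open>D \<otimes> D \<otimes> D\<close>. Pulling the outer \<open>T\<close> through \<open>\<alpha>' \<otimes> \<mu>\<close> and
  \<open>\<mu> \<otimes> \<beta>'\<close> turns them into
  \<open>\<mu> (\<alpha>' \<otimes> \<mu>) T1 (T \<otimes> id) (\<alpha> \<otimes> T)\<close> and
  \<open>\<mu> (\<mu> \<otimes> \<beta>') T2 (id \<otimes> T) (T \<otimes> \<beta>)\<close>; the tails agree by the last
  relation and the heads by the associativity law of \<open>\<mu>\<close>, extended from pure tensors to
  \<open>D \<otimes> D \<otimes> D\<close>.\<close>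

text \<open>Apply \<open>tensor_hom_eq\<close> twice: it leaves tensors \<open>y\<close> \<otimes>
  \<open>w\<close> with \<open>y\<close> arbitrary in \<open>U\<close> \<otimes> \<open>V\<close>;
  for fixed \<open>w\<close> both sides are linear in \<open>y\<close>, so pure \<open>y\<close>
  suffice.\<close>

lemma tensor_left_hom_eq:
  assumes U: "module K U" and V: "module K V" and W: "module K W" and X: "module K X"
    and f: "f \<in> module_hom K (tensor K (tensor K U V) W) X"
    and g: "g \<in> module_hom K (tensor K (tensor K U V) W) X"
    and eq: "\<And>u v w. u \<in> carrier U \<Longrightarrow> v \<in> carrier V \<Longrightarrow> w \<in> carrier W \<Longrightarrow>
      f (pure_tensor K (tensor K U V) W (pure_tensor K U V u v) w) =
      g (pure_tensor K (tensor K U V) W (pure_tensor K U V u v) w)"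
    and x: "x \<in> carrier (tensor K (tensor K U V) W)"
  shows "f x = g x"
proof (rule tensor_hom_eq[OF tensor_module[OF U V] W X f g _ x])
  fix y w assume y: "y \<in> carrier (tensor K U V)" and w: "w \<in> carrier W"
  note lin = module_hom_comp[OF pure_tensor_hom(2)[OF tensor_module[OF U V] W w]]
  show "f (pure_tensor K (tensor K U V) W y w) = g (pure_tensor K (tensor K U V) W y w)"
    by (rule tensor_hom_eq[OF U V X lin[OF f] lin[OF g] eq[OF _ _ w] y])
qed

text \<open>The same argument for the other bracketing, with the left factor \<open>u\<close> held
  fixed.\<close>

lemma tensor_right_hom_eq:
  assumes U: "module K U" and V: "module K V" and W: "module K W" and X: "module K X"
    and f: "f \<in> module_hom K (tensor K U (tensor K V W)) X"
    and g: "g \<in> module_hom K (tensor K U (tensor K V W)) X"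
    and eq: "\<And>u v w. u \<in> carrier U \<Longrightarrow> v \<in> carrier V \<Longrightarrow> w \<in> carrier W \<Longrightarrow>
      f (pure_tensor K U (tensor K V W) u (pure_tensor K V W v w)) =
      g (pure_tensor K U (tensor K V W) u (pure_tensor K V W v w))"
    and x: "x \<in> carrier (tensor K U (tensor K V W))"
  shows "f x = g x"
proof (rule tensor_hom_eq[OF U tensor_module[OF V W] X f g _ x])
  fix u y assume u: "u \<in> carrier U" and y: "y \<in> carrier (tensor K V W)"
  note lin = module_hom_comp[OF pure_tensor_hom(1)[OF U tensor_module[OF V W] u]]
  show "f (pure_tensor K U (tensor K V W) u y) = g (pure_tensor K U (tensor K V W) u y)"
    by (rule tensor_hom_eq[OF V W X lin[OF f] lin[OF g] eq[OF u] y])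
qed

text \<open>Both sides are linear and agree on iterated pure tensors. This serves to cancel
  associators on elements such as \<open>u\<close> \<otimes> \<open>T (v \<otimes> w)\<close>, where
  the inner tensor may fail to be pure and the evaluation rules do not apply.\<close>

lemma tensor_assoc_inverse:
  assumes U: "module K U" and V: "module K V" and W: "module K W"
    and x: "x \<in> carrier (tensor K U (tensor K V W))"
  shows "tensor_assoc K U V W (tensor_assoc_inv K U V W x) = x"
proof (rule tensor_right_hom_eq[OF U V W tensor_module[OF U tensor_module[OF V W]] _ _ _ x])
  show "(\<lambda>x. tensor_assoc K U V W (tensor_assoc_inv K U V W x))
      \<in> module_hom K (tensor K U (tensor K V W)) (tensor K U (tensor K V W))"
    by (rule module_hom_comp[OF tensor_assoc_inv(1)[OF U V W] tensor_assoc(1)[OF U V W]])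
  show "(\<lambda>x. x) \<in> module_hom K (tensor K U (tensor K V W)) (tensor K U (tensor K V W))"
    by (auto simp: module_hom_def)
qed (simp add: tensor_assoc(2)[OF U V W] tensor_assoc_inv(2)[OF U V W])

text \<open>Multiplicativity only speaks of pure tensors; linearity carries it to all tensors, in
  particular to values of \<open>T\<close>.\<close>

lemma multiplicative_tensor_map:
  assumes A: "module K A" and mu: "\<mu> \<in> module_hom K (tensor K A A) A"
    and f: "f \<in> module_hom K A A" and mult: "multiplicative K A \<mu> f"
    and x: "x \<in> carrier (tensor K A A)"
  shows "f (\<mu> x) = \<mu> (tensor_map K A A A A f f x)"
proof (rule tensor_hom_eq[OF A A A module_hom_comp[OF mu f] _ _ x])
  note ff = tensor_map[OF A A A A f f]
  show "(\<lambda>x. \<mu> (tensor_map K A A A A f f x)) \<in> module_hom K (tensor K A A) A"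
    by (rule module_hom_comp[OF ff(1) mu])
  show "\<And>a b. a \<in> carrier A \<Longrightarrow> b \<in> carrier A \<Longrightarrow> f (\<mu> (pure_tensor K A A a b)) =
      \<mu> (tensor_map K A A A A f f (pure_tensor K A A a b))"
    using mult by (simp add: ff(2) multiplicative_def)
qed

text \<open>On \<open>a\<close> \<otimes> \<open>b\<close>, first move \<open>f\<close> inside \<mu>
  as \<open>f\<close> \<otimes> \<open>f\<close>, then move \<open>f\<close> \<otimes>
  \<open>f\<close> past \<open>T\<close> by \<open>comm\<close>.\<close>

lemma multiplicative_twist:
  assumes A: "module K A" and mu: "\<mu> \<in> module_hom K (tensor K A A) A"
    and T: "T \<in> module_hom K (tensor K A A) (tensor K A A)"
    and f: "f \<in> module_hom K A A" and mult: "multiplicative K A \<mu> f"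
    and comm: "\<And>x. x \<in> carrier (tensor K A A) \<Longrightarrow>
      tensor_map K A A A A f f (T x) = T (tensor_map K A A A A f f x)"
  shows "multiplicative K A (\<mu> \<circ> T) f"
  using multiplicative_tensor_map[OF A mu f mult module_hom_closed[OF T, THEN funcset_mem]]
  by (simp add: multiplicative_def comm tensor_map(2)[OF A A A A f f] pure_tensor_closed[OF A A])

lemma multiplicative_comp:
  assumes "f \<in> carrier A \<rightarrow> carrier A" "multiplicative K A \<mu> f" "multiplicative K A \<mu> g"
  shows "multiplicative K A \<mu> (g \<circ> f)"
  using assms by (auto simp: multiplicative_def Pi_iff)

text \<open>Both sides are linear in \<open>x\<close> and reduce to \<open>bihom_assoc\<close> on
  iterated pure tensors. The general form is required because the law will be applied to a value of
  \<open>T1\<close>.\<close>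

lemma (in bihom_associative_algebra) bihom_assoc_tensor:
  assumes x: "x \<in> carrier (tensor3 K A)"
  shows "\<mu> (tensor_map_12_11 K A \<alpha> \<mu> x) = \<mu> (tensor_map_21_11 K A \<mu> \<beta> x)"
proof -
  note A = module_axioms
  note AA = tensor_module[OF A A]
  note defs = tensor_map_12_11_def tensor_map_21_11_def tensor2_def tensor3_def
  note mu = mu_linear[unfolded tensor2_def]
  note alpha_mu = tensor_map[OF A AA A A alpha_linear mu]
    and mu_beta = tensor_map[OF AA A A A mu beta_linear]
    and assoc = tensor_assoc[OF A A A]
  show ?thesis
  proof (rule tensor_left_hom_eq[OF A A A A _ _ _ x[unfolded defs]])
    show "(\<lambda>x. \<mu> (tensor_map_12_11 K A \<alpha> \<mu> x))
        \<in> module_hom K (tensor K (tensor K A A) A) A"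
      using module_hom_comp[OF module_hom_comp[OF assoc(1) alpha_mu(1)] mu] by (simp add: defs)
    show "(\<lambda>x. \<mu> (tensor_map_21_11 K A \<mu> \<beta> x))
        \<in> module_hom K (tensor K (tensor K A A) A) A"
      using module_hom_comp[OF mu_beta(1) mu] by (simp add: defs)
  qed (simp add: defs assoc(2) alpha_mu(2) mu_beta(2) pure_tensor_closed[OF A A] bihom_assoc)
qed

theorem theorem7p1:
  fixes K :: "('k, 'r) ring_scheme"
    and D :: "('k, 'd, 'm) module_scheme"
    and \<mu> :: "('d \<times> 'd \<Rightarrow> 'k) set \<Rightarrow> 'd"
    and \<alpha>' \<beta>' \<alpha> \<beta> :: "'d \<Rightarrow> 'd"
    and T :: "('d \<times> 'd \<Rightarrow> 'k) set \<Rightarrow> ('d \<times> 'd \<Rightarrow> 'k) set"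
    and T1 T2 :: "(('d \<times> 'd \<Rightarrow> 'k) set \<times> 'd \<Rightarrow> 'k) set \<Rightarrow> (('d \<times> 'd \<Rightarrow> 'k) set \<times> 'd \<Rightarrow> 'k) set"
  assumes D: "bihom_associative_algebra K D \<mu> \<alpha>' \<beta>'"
    and alpha: "\<alpha> \<in> module_hom K D D" "multiplicative K D \<mu> \<alpha>"
    and beta: "\<beta> \<in> module_hom K D D" "multiplicative K D \<mu> \<beta>"
    and commute: "\<forall>f \<in> {\<alpha>', \<beta>', \<alpha>, \<beta>}. \<forall>g \<in> {\<alpha>', \<beta>', \<alpha>, \<beta>}. commute_on (carrier D) f g"
    and T: "T \<in> module_hom K (tensor2 K D) (tensor2 K D)"
    and T1: "T1 \<in> module_hom K (tensor3 K D) (tensor3 K D)"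
    and T2: "T2 \<in> module_hom K (tensor3 K D) (tensor3 K D)"
    and T_alpha: "\<forall>x \<in> carrier (tensor2 K D).
      (tensor_map_11_11 K D \<alpha> \<alpha> \<circ> T) x = (T \<circ> tensor_map_11_11 K D \<alpha> \<alpha>) x"
    and T_beta: "\<forall>x \<in> carrier (tensor2 K D).
      (tensor_map_11_11 K D \<beta> \<beta> \<circ> T) x = (T \<circ> tensor_map_11_11 K D \<beta> \<beta>) x"
    and T_alpha': "\<forall>x \<in> carrier (tensor2 K D).
      (tensor_map_11_11 K D \<alpha>' \<alpha>' \<circ> T) x = (T \<circ> tensor_map_11_11 K D \<alpha>' \<alpha>') x"
    and T_beta': "\<forall>x \<in> carrier (tensor2 K D).
      (tensor_map_11_11 K D \<beta>' \<beta>' \<circ> T) x = (T \<circ> tensor_map_11_11 K D \<beta>' \<beta>') x"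
    and T_mu_right: "\<forall>x \<in> carrier (tensor3 K D).
      (T \<circ> tensor_map_12_11 K D \<alpha>' \<mu>) x =
      (tensor_map_12_11 K D \<alpha>' \<mu> \<circ> T1 \<circ> tensor_map_21_21 K D T id) x"
    and T_mu_left: "\<forall>x \<in> carrier (tensor3 K D).
      (T \<circ> tensor_map_21_11 K D \<mu> \<beta>') x =
      (tensor_map_21_11 K D \<mu> \<beta>' \<circ> T2 \<circ> tensor_map_12_12 K D id T) x"
    and T1_T2: "\<forall>x \<in> carrier (tensor3 K D).
      (T1 \<circ> tensor_map_21_21 K D T id \<circ> tensor_map_12_12 K D \<alpha> T) x =
      (T2 \<circ> tensor_map_12_12 K D id T \<circ> tensor_map_21_21 K D T \<beta>) x"
  shows "bihom_associative_algebra K D (\<mu> \<circ> T) (\<alpha>' \<circ> \<alpha>) (\<beta>' \<circ> \<beta>)"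
proof -
  interpret D: bihom_associative_algebra K D \<mu> \<alpha>' \<beta>' by (rule D)
  note M = D.module_axioms
  note MM = tensor_module[OF M M]
  note mu = D.mu_linear[unfolded tensor2_def]
    and alpha' = D.alpha_linear and beta' = D.beta_linear
    and T = T[unfolded tensor2_def]
  note closed = module_hom_closed[THEN funcset_mem]
  have comm: "f (g x) = g (f x)"
    if "f \<in> {\<alpha>', \<beta>', \<alpha>, \<beta>}" "g \<in> {\<alpha>', \<beta>', \<alpha>, \<beta>}" "x \<in> carrier D" for f g x
    using commute that unfolding commute_on_def by blast
  note twist = multiplicative_twist[OF M mu T]
  note defs = tensor_map_11_11_def tensor2_def comp_apply
  \<comment> \<open>Each factor is multiplicative for the twisted product because it commutes with
    \<open>T\<close>; composition preserves this.\<close>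
  have twist_alpha: "multiplicative K D (\<mu> \<circ> T) (\<alpha>' \<circ> \<alpha>)"
    using T_alpha T_alpha' alpha alpha' D.alpha_mult
    by (intro multiplicative_comp twist module_hom_closed[OF alpha(1)]) (auto simp: defs)
  have twist_beta: "multiplicative K D (\<mu> \<circ> T) (\<beta>' \<circ> \<beta>)"
    using T_beta T_beta' beta beta' D.beta_mult
    by (intro multiplicative_comp twist module_hom_closed[OF beta(1)]) (auto simp: defs)
  have assoc: "\<mu> (T (pure_tensor K D D (\<alpha>' (\<alpha> a)) (\<mu> (T (pure_tensor K D D b c))))) =
      \<mu> (T (pure_tensor K D D (\<mu> (T (pure_tensor K D D a b))) (\<beta>' (\<beta> c))))"
    if abc: "a \<in> carrier D" "b \<in> carrier D" "c \<in> carrier D" for a b c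
  proof -
    let ?D2 = "tensor K D D"
    let ?D3 = "tensor K ?D2 D"
    \<comment> \<open>With \<open>x\<close> = \<open>a\<close> \<otimes> \<open>b\<close> \<otimes>
      \<open>c\<close>, the two sides of the law are \<mu> \<open>T\<close> (\<alpha>' \<otimes>
      \<mu>) \<open>y\<close> and \<mu> \<open>T\<close> (\<mu> \<otimes> \<beta>')
      \<open>z\<close>, where \<open>y\<close> and \<open>z\<close> are the innermost stages of the
      two sides of \<open>T1_T2\<close> at \<open>x\<close>.\<close>
    define x where "x = pure_tensor K ?D2 D (pure_tensor K D D a b) c"
    define y where "y = tensor_map_12_12 K D \<alpha> T x"
    define z where "z = tensor_map_21_21 K D T \<beta> x"
    have id: "id \<in> module_hom K D D" by (auto simp: module_hom_def)
    have ab: "pure_tensor K D D a b \<in> carrier ?D2" and bc: "pure_tensor K D D b c \<in> carrier ?D2"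
      using abc by (simp_all add: pure_tensor_closed[OF M M])
    have x: "x \<in> carrier ?D3"
      using ab abc(3) by (simp add: x_def pure_tensor_closed[OF MM M])
    have aT: "pure_tensor K D ?D2 (\<alpha> a) (T (pure_tensor K D D b c)) \<in> carrier (tensor K D ?D2)"
      using abc bc by (intro pure_tensor_closed[OF M MM] closed[OF T] closed[OF alpha(1)])
    \<comment> \<open>The associator rebrackets \<open>x\<close> so that \<alpha> \<otimes>
      \<open>T\<close> can act. The inverse associator stays unevaluated, as
      \<open>T (b \<otimes> c)\<close> may not be pure.\<close>
    have y_eq: "y = tensor_assoc_inv K D D D
        (pure_tensor K D ?D2 (\<alpha> a) (T (pure_tensor K D D b c)))"
      using abc bc by (simp add: y_def x_def tensor_map_12_12_def tensor2_def
        tensor_assoc(2)[OF M M M] tensor_map(2)[OF M MM M MM alpha(1) T])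
    have y: "y \<in> carrier ?D3"
      using aT by (simp add: y_eq closed[OF tensor_assoc_inv(1)[OF M M M]])
    have z_eq: "z = pure_tensor K ?D2 D (T (pure_tensor K D D a b)) (\<beta> c)"
      using abc ab by (simp add: z_def x_def tensor_map_21_21_def tensor2_def
        tensor_map(2)[OF MM M MM M T beta(1)])
    have z: "z \<in> carrier ?D3"
      using abc ab by (auto simp: z_eq intro!: pure_tensor_closed[OF MM M] closed[OF T] closed[OF beta(1)])
    \<comment> \<open>The associator at the start of \<open>tensor_map_12_11\<close> cancels the
      inverse one left in \<open>y\<close>.\<close>
    have alpha_mu: "tensor_map_12_11 K D \<alpha>' \<mu> y =
        pure_tensor K D D (\<alpha>' (\<alpha> a)) (\<mu> (T (pure_tensor K D D b c)))"
      using abc bc by (simp add: tensor_map_12_11_def tensor2_def y_eq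
        tensor_assoc_inverse[OF M M M aT] tensor_map(2)[OF M MM M M alpha' mu]
        closed[OF T] closed[OF alpha(1)])
    have mu_beta: "tensor_map_21_11 K D \<mu> \<beta>' z =
        pure_tensor K D D (\<mu> (T (pure_tensor K D D a b))) (\<beta>' (\<beta> c))"
      using abc ab by (simp add: tensor_map_21_11_def tensor2_def z_eq
        tensor_map(2)[OF MM M M M mu beta'] closed[OF T] closed[OF beta(1)])
    have "tensor_map_21_21 K D T id y \<in> carrier (tensor3 K D)"
      using closed[OF tensor_map(1)[OF MM M MM M T id] y]
      by (simp add: tensor_map_21_21_def tensor2_def tensor3_def)
    then have w: "T1 (tensor_map_21_21 K D T id y) \<in> carrier (tensor3 K D)"
      by (rule closed[OF T1])
    \<comment> \<open>The relations enter at different arguments: \<open>T_mu_right\<close> at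
      \<open>y\<close>, \<open>T1_T2\<close> at \<open>x\<close>, and \<open>T_mu_left\<close>, read
      from right to left, at \<open>z\<close>.\<close>
    have "\<mu> (T (tensor_map_12_11 K D \<alpha>' \<mu> y)) =
        \<mu> (tensor_map_12_11 K D \<alpha>' \<mu> (T1 (tensor_map_21_21 K D T id y)))"
      using T_mu_right y by (simp add: tensor3_def tensor2_def)
    also have "\<dots> = \<mu> (tensor_map_21_11 K D \<mu> \<beta>' (T1 (tensor_map_21_21 K D T id y)))"
      by (rule D.bihom_assoc_tensor[OF w])
    also have "T1 (tensor_map_21_21 K D T id y) = T2 (tensor_map_12_12 K D id T z)"
      using T1_T2 x by (simp add: y_def z_def tensor3_def tensor2_def)
    also have "\<mu> (tensor_map_21_11 K D \<mu> \<beta>' (T2 (tensor_map_12_12 K D id T z))) =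
        \<mu> (T (tensor_map_21_11 K D \<mu> \<beta>' z))"
      using T_mu_left z by (simp add: tensor3_def tensor2_def)
    finally show ?thesis by (simp add: alpha_mu mu_beta)
  qed
  \<comment> \<open>The vector space structure is that of \<open>D\<close>; what remains is
    linearity of the three new maps, their commutation, two multiplicativity claims and the
    law.\<close>
  show ?thesis
  proof (unfold_locales, goal_cases)
    case 1
    show ?case using module_hom_comp[OF T mu] by (simp add: tensor2_def comp_def)
  next
    case 2
    show ?case using module_hom_comp[OF alpha(1) alpha'] by (simp add: comp_def)
  next
    case 3
    show ?case using module_hom_comp[OF beta(1) beta'] by (simp add: comp_def)
  next
    case 4
    show ?case
      \<comment> \<open>\<open>comm\<close> is a permutative rule: ordered rewriting sorts the four
        maps into the same order on both sides, and the closure facts discharge its carrier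
        condition.\<close>
      by (simp add: commute_on_def comm closed[OF alpha(1)] closed[OF beta(1)]
        closed[OF alpha'] closed[OF beta'])
  next
    case 5
    show ?case by (rule twist_alpha)
  next
    case 6
    show ?case by (rule twist_beta)
  next
    case (7 a a' a'')
    then show ?case by (simp add: assoc)
  qed
qed

end
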